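(* Let $n\ge 1$ and let $f\in\mathcal F_n$ be a subtype. Then $f$ is regular (i.e. $f\in\mathcal R_{n,O_f}$) if and only if $f$ is monotone (i.e. $s\le_{O_f}s'$ implies $f(s)\le f(s')$ for all $s,s'\in\{0,1\}^n$).
   Context: Notation. $[n]=\{1,\dots,n\}$; $\theta=\theta_n\in\{0,1\}^n$ is the zero string. $\mathcal F_n=\{f:\{0,1\}^n\to\{0,1\} : f(\theta)=1\}$ is a Boolean algebra for the pointwise order, with $\vee,\wedge$ the pointwise maximum/minimum; its bottom element $p_n$ is the indicator function of $\{\theta\}$, its top element $1_n$ is the constant function $1$, and the complement is $f^*=1-f+p_n$. For $T\subseteq[n]$, $p_T(s)=\prod_{i\in T}(1-s_i)$ (so $p_\emptyset=1_n$, $p_{[n]}=p_n$). For $f\in\mathcal F_m$, $g\in\mathcal F_n$, $f\otimes g\in\mathcal F_{m+n}$ is $(f\otimes g)(s^1s^2)=f(s^1)g(s^2)$, where $s=s^1s^2$ is the concatenation with $s^1\in\{0,1\}^m$, $s^2\in\{0,1\}^n$. A permutation $\sigma$ of $[n]$ acts on strings by $\sigma(s)=s_{\sigma^{-1}(1)}\dots s_{\sigma^{-1}(n)}$, and $f\circ\sigma$ is the composition. Inputs/outputs. Let $e^i\in\{0,1\}^n$ be the string with $e^i_j=\delta_{i,j}$. For $f\in\mathcal F_n$: $I_f=\{i: f(e^i)=0\}$, $O_f=\{j: f(e^j)=1\}$. Type functions. The sets $\mathcal T_n\subseteq\mathcal F_n$ ($n\ge1$) of type functions form the smallest family with $1_1\in\mathcal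 T_1$ that is closed under $f\mapsto f^*$, under $f\mapsto f\circ\sigma$ (all permutations $\sigma$), and under $(f,g)\mapsto f\otimes g$ (from $\mathcal T_m\times\mathcal T_n$ to $\mathcal T_{m+n}$). For $O\subseteq[n]$, $\mathcal T_{n,O}=\{f\in\mathcal T_n: O_f=O\}$. Subtypes. $f\in\mathcal F_n$ is a subtype if $p_{I_f}\le f\le p_{O_f}^*$. $\mathcal R_{n,O}$ denotes the sublattice of $\mathcal F_n$ (under $\vee,\wedge$) generated by $\mathcal T_{n,O}$; its elements are called regular subtypes (with outputs in $O$). Order. For $O\subseteq[n]$, $s\le_O s'$ in $\{0,1\}^n$ means $s_i\le s_i'$ for $i\in O$ and $s_i\ge s_i'$ for $i\notin O$. *)

theory Defs
  imports Main "HOL-Combinatorics.Permutations"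
begin

text \<open>
  Conventions. The bits 0, 1 are \<open>False\<close>, \<open>True\<close> (the library order on \<^typ>\<open>bool\<close> is
  \<open>0 \<le> 1\<close>), a string in \<open>{0,1}\<^sup>n\<close> is a \<^typ>\<open>bool list\<close> of length \<open>n\<close>, and positions are counted
  from 0, so that \<open>{..<n}\<close> stands for \<open>[n]\<close>. A function on \<open>{0,1}\<^sup>n\<close> is represented by a function
  on all bit lists that is \<open>False\<close> on lists of any other length. With this normalisation, equality,
  \<open>\<le>\<close>, \<open>sup\<close> and \<open>inf\<close> of the library on the type \<open>bool list \<Rightarrow> bool\<close> are equality, pointwise order,
  pointwise maximum and pointwise minimum of functions on \<open>{0,1}\<^sup>n\<close>.
\<close>

definition strings :: "nat \<Rightarrow> bool list set" where
  "strings n = {s. length s = n}"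

definition zero_string :: "nat \<Rightarrow> bool list" where
  "zero_string n = replicate n False"

definition unit_string :: "nat \<Rightarrow> nat \<Rightarrow> bool list" where
  "unit_string n i = map (\<lambda>j. j = i) [0..<n]"

definition bool_fns :: "nat \<Rightarrow> (bool list \<Rightarrow> bool) set" where
  "bool_fns n = {f. f (zero_string n) \<and> (\<forall>s. s \<notin> strings n \<longrightarrow> \<not> f s)}"

definition p_fn :: "nat \<Rightarrow> nat set \<Rightarrow> bool list \<Rightarrow> bool" where
  "p_fn n T = (\<lambda>s. s \<in> strings n \<and> (\<forall>i\<in>T. \<not> s ! i))"

definition compl_fn :: "nat \<Rightarrow> (bool list \<Rightarrow> bool) \<Rightarrow> bool list \<Rightarrow> bool" where
  "compl_fn n f = (\<lambda>s. s \<in> strings n \<and> (\<not> f s \<or> s = zero_string n))"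

definition tensor_fn :: "nat \<Rightarrow> nat \<Rightarrow> (bool list \<Rightarrow> bool) \<Rightarrow> (bool list \<Rightarrow> bool) \<Rightarrow> bool list \<Rightarrow> bool" where
  "tensor_fn m n f g = (\<lambda>s. s \<in> strings (m + n) \<and> f (take m s) \<and> g (drop m s))"

text \<open>Since \<^term>\<open>permute_list \<pi> s ! i = s ! \<pi> i\<close>, the action uses the inverse of \<open>\<sigma>\<close>.\<close>

definition perm_string :: "(nat \<Rightarrow> nat) \<Rightarrow> bool list \<Rightarrow> bool list" where
  "perm_string \<sigma> s = permute_list (inv \<sigma>) s"

definition inputs :: "nat \<Rightarrow> (bool list \<Rightarrow> bool) \<Rightarrow> nat set" where
  "inputs n f = {i. i < n \<and> \<not> f (unit_string n i)}"

definition outputs :: "nat \<Rightarrow> (bool list \<Rightarrow> bool) \<Rightarrow> nat set" where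
  "outputs n f = {j. j < n \<and> f (unit_string n j)}"

inductive type_fn :: "nat \<Rightarrow> (bool list \<Rightarrow> bool) \<Rightarrow> bool" where
  one: "type_fn 1 (p_fn 1 {})"
| compl: "type_fn n f \<Longrightarrow> type_fn n (compl_fn n f)"
| perm: "type_fn n f \<Longrightarrow> \<sigma> permutes {..<n} \<Longrightarrow> type_fn n (f \<circ> perm_string \<sigma>)"
| tensor: "type_fn m f \<Longrightarrow> type_fn n g \<Longrightarrow> type_fn (m + n) (tensor_fn m n f g)"

definition type_fns_with_outputs :: "nat \<Rightarrow> nat set \<Rightarrow> (bool list \<Rightarrow> bool) set" where
  "type_fns_with_outputs n Out = {f. type_fn n f \<and> outputs n f = Out}"

inductive_set gen_sublattice :: "'a::lattice set \<Rightarrow> 'a set" for A where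
  base: "x \<in> A \<Longrightarrow> x \<in> gen_sublattice A"
| sup: "x \<in> gen_sublattice A \<Longrightarrow> y \<in> gen_sublattice A \<Longrightarrow> sup x y \<in> gen_sublattice A"
| inf: "x \<in> gen_sublattice A \<Longrightarrow> y \<in> gen_sublattice A \<Longrightarrow> inf x y \<in> gen_sublattice A"

definition regular_subtypes :: "nat \<Rightarrow> nat set \<Rightarrow> (bool list \<Rightarrow> bool) set" where
  "regular_subtypes n Out = gen_sublattice (type_fns_with_outputs n Out)"

definition subtype :: "nat \<Rightarrow> (bool list \<Rightarrow> bool) \<Rightarrow> bool" where
  "subtype n f \<longleftrightarrow> f \<in> bool_fns n \<and>
     p_fn n (inputs n f) \<le> f \<and> f \<le> compl_fn n (p_fn n (outputs n f))"

definition string_le :: "nat \<Rightarrow> nat set \<Rightarrow> bool list \<Rightarrow> bool list \<Rightarrow> bool" where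
  "string_le n Out s s' \<longleftrightarrow> (\<forall>i<n. if i \<in> Out then s ! i \<le> s' ! i else s' ! i \<le> s ! i)"


text \<open>The numerical formulas behind the Boolean-valued definitions.\<close>

lemma p_fn_eq_prod:
  assumes "T \<subseteq> {..<n}" "s \<in> strings n"
  shows "(of_bool (p_fn n T s) :: int) = (\<Prod>i\<in>T. 1 - of_bool (s ! i))"
proof -
  have "finite T" using assms(1) finite_subset by blast
  then show ?thesis using assms(2) by (auto simp: p_fn_def of_bool_def)
qed

lemma p_fn_full: "p_fn n {..<n} s \<longleftrightarrow> s = zero_string n"
  by (auto simp: p_fn_def zero_string_def strings_def list_eq_iff_nth_eq)

lemma compl_fn_eq_diff:
  assumes "f \<in> bool_fns n" "s \<in> strings n"
  shows "(of_bool (compl_fn n f s) :: int) = 1 - of_bool (f s) + of_bool (p_fn n {..<n} s)"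
  using assms by (auto simp: compl_fn_def p_fn_full bool_fns_def)

lemma tensor_fn_append:
  assumes "s1 \<in> strings m" "s2 \<in> strings n"
  shows "tensor_fn m n f g (s1 @ s2) \<longleftrightarrow> f s1 \<and> g s2"
  using assms by (auto simp: tensor_fn_def strings_def)

lemma type_fn_in_bool_fns: "type_fn n f \<Longrightarrow> f \<in> bool_fns n"
proof (induction rule: type_fn.induct)
  case (perm n f \<sigma>)
  have "inv \<sigma> i < n" if "i < n" for i
    using permutes_in_image[OF permutes_inv[OF perm.hyps(2)], of i] that by simp
  then have "perm_string \<sigma> (zero_string n) = zero_string n"
    by (auto simp: perm_string_def zero_string_def list_eq_iff_nth_eq permute_list_def)
  with perm show ?case by (auto simp: bool_fns_def strings_def perm_string_def)
qed (auto simp: bool_fns_def p_fn_def compl_fn_def tensor_fn_def strings_def zero_string_def)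

end

theory Submission
  imports Defs
begin

text \<open>
  A type function is monotone for its own outputs and lies below \<open>p\<^sub>O\<^sup>*\<close>; the two properties
  have to be proved together, since complementation exchanges \<open>O\<close> and \<open>I\<close> but fixes the value at
  the zero string. Both survive joins and meets, which gives one direction.

  Conversely, a function is in the lattice generated by a family as soon as the family separates
  every point \<open>u\<close> with \<open>f u = 1\<close> from every point \<open>v\<close> with \<open>f v = 0\<close>. For a monotone subtype,
  \<open>u \<le>\<^sub>O v\<close> fails. Up to the extreme cases, settled by \<open>p\<^sub>I\<close> and \<open>p\<^sub>O\<^sup>*\<close>, either some
  output \<open>i\<close> has \<open>u\<^sub>i = 1\<close>, \<open>v\<^sub>i = 0\<close>, and the type ``everything flows from \<open>I\<close> to \<open>i\<close>, the other
  outputs are free'' separates, or some input does the dual and the complement of the dual type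
  separates.
\<close>

section \<open>Lattices generated by a separating family\<close>

lemma gen_sublattice_Sup:
  fixes A :: "'a::complete_lattice set"
  assumes "finite B" "B \<noteq> {}" "B \<subseteq> gen_sublattice A"
  shows "Sup B \<in> gen_sublattice A"
  using assms by (induction B rule: finite_ne_induct) (auto intro: gen_sublattice.sup)

lemma gen_sublattice_Inf:
  fixes A :: "'a::complete_lattice set"
  assumes "finite B" "B \<noteq> {}" "B \<subseteq> gen_sublattice A"
  shows "Inf B \<in> gen_sublattice A"
  using assms by (induction B rule: finite_ne_induct) (auto intro: gen_sublattice.inf)

text \<open>\<open>f\<close> is the join over \<open>u\<close> of the meets over \<open>v\<close> of
  the separating functions. Finiteness of \<open>S\<close> makes both operations finite, and
  \<open>ne\<close> makes them nonempty, since a generated sublattice need not contain the empty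
  join or meet.\<close>

lemma gen_sublattice_if_separating:
  fixes f :: "'a \<Rightarrow> bool"
  assumes "finite S" and f_supp: "\<And>x. f x \<Longrightarrow> x \<in> S"
    and A_supp: "\<And>t x. t \<in> A \<Longrightarrow> t x \<Longrightarrow> x \<in> S"
    and ne: "\<exists>u. f u" "\<exists>v\<in>S. \<not> f v"
    and sep: "\<And>u v. f u \<Longrightarrow> v \<in> S \<Longrightarrow> \<not> f v \<Longrightarrow> \<exists>t\<in>A. t u \<and> \<not> t v"
  shows "f \<in> gen_sublattice A"
proof -
  define U where "U = {u. f u}"
  define V where "V = {v\<in>S. \<not> f v}"
  have fin: "finite U" "finite V"
    using assms(1) f_supp by (auto simp: U_def V_def intro: finite_subset)
  have nonempty: "U \<noteq> {}" "V \<noteq> {}" using ne by (auto simp: U_def V_def)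
  obtain t where t: "\<And>u v. u \<in> U \<Longrightarrow> v \<in> V \<Longrightarrow> t u v \<in> A \<and> t u v u \<and> \<not> t u v v"
    using sep unfolding U_def V_def by (simp, metis)
  have "(SUP u\<in>U. INF v\<in>V. t u v) \<in> gen_sublattice A"
    using fin nonempty t
    by (intro gen_sublattice_Sup gen_sublattice_Inf image_subsetI)
       (auto intro!: gen_sublattice_Inf gen_sublattice.base)
  also have "(SUP u\<in>U. INF v\<in>V. t u v) = f"
  proof
    fix x
    \<comment> \<open>\<open>A_supp\<close>, applied with some \<open>v\<close> of the nonempty
      \<open>V\<close>, puts \<open>x\<close> into \<open>S\<close>; if \<open>f x\<close> failed,
      \<open>x\<close> would lie in \<open>V\<close>, where \<open>t u x x\<close> is false.\<close>
    have "f x" if "u \<in> U" "\<forall>v\<in>V. t u v x" for u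
      using that t A_supp nonempty(2) by (auto simp: V_def) metis
    moreover have "x \<in> U" if "f x" using that by (simp add: U_def)
    ultimately show "(SUP u\<in>U. INF v\<in>V. t u v) x = f x" using t by auto
  qed
  finally show ?thesis .
qed

section \<open>Strings, and outputs under complement, permutation and tensor product\<close>

lemma finite_strings: "finite (strings n)"
  using finite_lists_length_eq[of "UNIV :: bool set" n] by (simp add: strings_def)

lemma nth_unit_string: "k < n \<Longrightarrow> unit_string n i ! k \<longleftrightarrow> k = i"
  by (simp add: unit_string_def)

lemma unit_string_in_strings: "unit_string n i \<in> strings n"
  by (simp add: strings_def unit_string_def)

lemma zero_string_in_strings: "zero_string n \<in> strings n"
  by (simp add: strings_def zero_string_def)

lemma eq_zero_string_iff: "s \<in> strings n \<Longrightarrow> s = zero_string n \<longleftrightarrow> (\<forall>i<n. \<not> s ! i)"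
  by (auto simp: strings_def zero_string_def list_eq_iff_nth_eq)

lemma unit_string_neq_zero_string: "i < n \<Longrightarrow> unit_string n i \<noteq> zero_string n"
  using eq_zero_string_iff[OF unit_string_in_strings] nth_unit_string by blast

lemma take_unit_string:
  "take m (unit_string (m + n) i) = (if i < m then unit_string m i else zero_string m)"
  by (auto simp: list_eq_iff_nth_eq unit_string_def zero_string_def)

lemma drop_unit_string:
  "drop m (unit_string (m + n) i) = (if i < m then zero_string n else unit_string n (i - m))"
  by (auto simp: list_eq_iff_nth_eq unit_string_def zero_string_def)

lemma string_le_D:
  assumes "string_le n Out s s'" "i < n"
  shows "i \<in> Out \<Longrightarrow> s ! i \<Longrightarrow> s' ! i" "i \<notin> Out \<Longrightarrow> s' ! i \<Longrightarrow> s ! i"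
  using assms by (auto simp: string_le_def split: if_splits)

lemma outputs_compl_fn: "outputs n (compl_fn n f) = {..<n} - outputs n f"
  by (auto simp: outputs_def compl_fn_def unit_string_in_strings unit_string_neq_zero_string)

lemma nth_perm_string:
  assumes "\<sigma> permutes {..<n}" "s \<in> strings n" "k < n"
  shows "perm_string \<sigma> s ! k = s ! inv \<sigma> k"
  using assms by (simp add: perm_string_def strings_def permute_list_nth permutes_inv)

lemma perm_string_in_strings: "s \<in> strings n \<Longrightarrow> perm_string \<sigma> s \<in> strings n"
  by (simp add: perm_string_def strings_def)

lemma perm_string_unit_string:
  assumes "\<sigma> permutes {..<n}"
  shows "perm_string \<sigma> (unit_string n i) = unit_string n (\<sigma> i)"
proof (rule nth_equalityI)
  fix k assume "k < length (perm_string \<sigma> (unit_string n i))"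
  then have "k < n" by (simp add: perm_string_def unit_string_def)
  moreover then have "inv \<sigma> k < n"
    using permutes_in_image[OF permutes_inv[OF assms], of k] by simp
  ultimately show "perm_string \<sigma> (unit_string n i) ! k = unit_string n (\<sigma> i) ! k"
    using assms permutes_inv_eq[OF assms, of k i]
    by (auto simp: nth_perm_string unit_string_in_strings nth_unit_string)
qed (simp add: perm_string_def unit_string_def)

lemma outputs_perm:
  assumes "\<sigma> permutes {..<n}"
  shows "i \<in> outputs n (f \<circ> perm_string \<sigma>) \<longleftrightarrow> \<sigma> i \<in> outputs n f"
  using permutes_in_image[OF assms, of i]
  by (auto simp: outputs_def perm_string_unit_string[OF assms])

text \<open>A unit string splits into a unit string and a zero string, and each factor is 1 at its
  zero string, so only the factor holding the 1 matters.\<close>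

lemma outputs_tensor_fn:
  assumes "f \<in> bool_fns m" "g \<in> bool_fns n"
  shows "outputs (m + n) (tensor_fn m n f g) = outputs m f \<union> (+) m ` outputs n g"
proof -
  have "i \<in> (+) m ` outputs n g \<longleftrightarrow> m \<le> i \<and> i - m \<in> outputs n g" for i
    by (auto simp: image_iff) (metis le_add_diff_inverse)
  then show ?thesis
    using assms
    by (auto simp: outputs_def tensor_fn_def unit_string_in_strings bool_fns_def
        take_unit_string drop_unit_string split: if_splits)
qed

section \<open>Monotonicity of type functions and regular subtypes\<close>

text \<open>The zero string lies below \<open>s\<close> in the order, and \<open>f\<close> is 1
  there. This is the lower bound \<open>p\<^sub>I \<le> f\<close>, obtained from
  monotonicity.\<close>

lemma monotone_if_zero_on_inputs:
  assumes "monotone_on (strings n) (string_le n (outputs n f)) (\<le>) f" "f \<in> bool_fns n"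
    and "s \<in> strings n" "\<And>i. i < n \<Longrightarrow> i \<notin> outputs n f \<Longrightarrow> \<not> s ! i"
  shows "f s"
proof -
  have "string_le n (outputs n f) (zero_string n) s"
    using assms(4) by (auto simp: string_le_def zero_string_def)
  then have "f (zero_string n) \<le> f s"
    using assms(1,3) zero_string_in_strings by (auto simp: monotone_on_def)
  then show ?thesis using assms(2) by (simp add: bool_fns_def)
qed

lemma type_fn_monotone_bounded:
  assumes "type_fn n f"
  shows "monotone_on (strings n) (string_le n (outputs n f)) (\<le>) f \<and>
    (\<forall>s. f s \<longrightarrow> s \<noteq> zero_string n \<longrightarrow> (\<exists>j\<in>outputs n f. s ! j))"
  using assms
proof (induction rule: type_fn.induct)
  case one
  have "outputs 1 (p_fn 1 {}) = {..<1}"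
    by (auto simp: outputs_def p_fn_def unit_string_in_strings)
  moreover have "s ! 0" if "p_fn 1 {} s" "s \<noteq> zero_string 1" for s
    using that eq_zero_string_iff[of s 1] by (auto simp: p_fn_def)
  ultimately show ?case by (auto simp: monotone_on_def p_fn_def)
next
  case (compl n f)
  note f = type_fn_in_bool_fns[OF compl.hyps]
  have mono: "monotone_on (strings n) (string_le n (outputs n f)) (\<le>) f"
    and bound: "\<And>s. f s \<Longrightarrow> s \<noteq> zero_string n \<Longrightarrow> \<exists>j\<in>outputs n f. s ! j"
    using compl.IH by blast+
  have "compl_fn n f s'"
    if st: "s \<in> strings n" "s' \<in> strings n" and le: "string_le n ({..<n} - outputs n f) s s'"
      and s: "compl_fn n f s" for s s'
  proof (rule ccontr)
    assume "\<not> compl_fn n f s'"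
    then have s': "f s'" "s' \<noteq> zero_string n" using st by (auto simp: compl_fn_def)
    have "string_le n (outputs n f) s' s"
      using string_le_D[OF le] by (auto simp: string_le_def)
    then have "f s" using mono st s'(1) by (auto simp: monotone_on_def)
    \<comment> \<open>The zero string is the only point where \<open>f\<close> and its complement
      are both 1. There the bound helps: it gives an output \<open>j\<close> of \<open>f\<close>
      with a 1 in \<open>s'\<close>; as an input of the complement, \<open>j\<close> forces a 1 in
      \<open>s\<close> too.\<close>
    then have "s = zero_string n" using s by (auto simp: compl_fn_def)
    moreover obtain j where "j \<in> outputs n f" "s' ! j" using bound s' by blast
    ultimately show False
      using string_le_D(2)[OF le, of j] by (auto simp: outputs_def zero_string_def)
  qed
  moreover have "\<exists>j\<in>{..<n} - outputs n f. s ! j"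
    if "compl_fn n f s" "s \<noteq> zero_string n" for s
  proof (rule ccontr)
    assume "\<not> ?thesis"
    \<comment> \<open>The upper bound for the complement is the lower bound for \<open>f\<close>:
      the outputs of one are the inputs of the other.\<close>
    then have "f s"
      using that monotone_if_zero_on_inputs[OF mono f, of s] by (auto simp: compl_fn_def)
    then show False using that by (simp add: compl_fn_def)
  qed
  ultimately show ?case by (auto simp: outputs_compl_fn monotone_on_def)
next
  case (perm n f \<sigma>)
  let ?g = "f \<circ> perm_string \<sigma>"
  note \<sigma> = perm.hyps(2)
  have g: "?g \<in> bool_fns n"
    using perm.hyps type_fn.perm type_fn_in_bool_fns by blast
  have inv_lt: "inv \<sigma> i < n" if "i < n" for i
    using permutes_in_image[OF permutes_inv[OF \<sigma>], of i] that by simp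
  \<comment> \<open>Place \<open>i\<close> of \<open>perm_string \<sigma> s\<close> holds the bit
    \<open>inv \<sigma> i\<close> of \<open>s\<close>, so outputs are compared along
    \<open>inv \<sigma>\<close>.\<close>
  have out: "inv \<sigma> i \<in> outputs n ?g \<longleftrightarrow> i \<in> outputs n f" for i
    using outputs_perm[OF \<sigma>] permutes_inverses(1)[OF \<sigma>] by simp
  have "string_le n (outputs n f) (perm_string \<sigma> s) (perm_string \<sigma> s')"
    if "s \<in> strings n" "s' \<in> strings n" "string_le n (outputs n ?g) s s'" for s s'
    unfolding string_le_def
    using that string_le_D[OF that(3) inv_lt] out by (auto simp: nth_perm_string[OF \<sigma>])
  then have "monotone_on (strings n) (string_le n (outputs n ?g)) (\<le>) ?g"
    using perm.IH perm_string_in_strings unfolding monotone_on_def comp_def by blast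
  moreover have "\<exists>j\<in>outputs n ?g. s ! j" if gs: "?g s" and nz: "s \<noteq> zero_string n" for s
  proof -
    have s: "s \<in> strings n" using gs g by (auto simp: bool_fns_def)
    obtain i where i: "i < n" "s ! i" using nz eq_zero_string_iff[OF s] by blast
    then have "\<sigma> i < n" using permutes_in_image[OF \<sigma>, of i] by simp
    moreover have "perm_string \<sigma> s ! \<sigma> i"
      using i nth_perm_string[OF \<sigma> s \<open>\<sigma> i < n\<close>] permutes_inverses(2)[OF \<sigma>] by simp
    ultimately have "perm_string \<sigma> s \<noteq> zero_string n" by (auto simp: zero_string_def)
    then obtain j where j: "j \<in> outputs n f" "perm_string \<sigma> s ! j" using perm.IH gs by auto
    then have "s ! inv \<sigma> j" using nth_perm_string[OF \<sigma> s] by (auto simp: outputs_def)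
    then show ?thesis using j(1) out by blast
  qed
  ultimately show ?case by blast
next
  case (tensor m f n g)
  have f: "f \<in> bool_fns m" and g: "g \<in> bool_fns n"
    using tensor.hyps type_fn_in_bool_fns by blast+
  note out = outputs_tensor_fn[OF f g]
  have "outputs m f \<subseteq> {..<m}" by (auto simp: outputs_def)
  then have low: "i \<in> outputs (m + n) (tensor_fn m n f g) \<longleftrightarrow> i \<in> outputs m f" if "i < m" for i
    using that out by auto
  have high: "m + i \<in> outputs (m + n) (tensor_fn m n f g) \<longleftrightarrow> i \<in> outputs n g" for i
    using \<open>outputs m f \<subseteq> {..<m}\<close> out by auto
  have "tensor_fn m n f g s'"
    if st: "s \<in> strings (m + n)" "s' \<in> strings (m + n)"
      and le: "string_le (m + n) (outputs (m + n) (tensor_fn m n f g)) s s'"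
      and s: "tensor_fn m n f g s" for s s'
  proof -
    have split: "take m s \<in> strings m" "take m s' \<in> strings m"
      "drop m s \<in> strings n" "drop m s' \<in> strings n"
      using st by (auto simp: strings_def)
    have "string_le m (outputs m f) (take m s) (take m s')"
      unfolding string_le_def using string_le_D[OF le] low by auto
    moreover have "string_le n (outputs n g) (drop m s) (drop m s')"
      unfolding string_le_def using string_le_D[OF le, of "m + _"] high st
      by (auto simp: strings_def)
    ultimately show ?thesis
      using tensor.IH s st split by (auto simp: tensor_fn_def monotone_on_def)
  qed
  moreover have "\<exists>j\<in>outputs (m + n) (tensor_fn m n f g). s ! j"
    if s: "tensor_fn m n f g s" and nz: "s \<noteq> zero_string (m + n)" for s
  proof -
    have fs: "f (take m s)" "g (drop m s)" and len: "s \<in> strings (m + n)"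
      using s by (auto simp: tensor_fn_def)
    have "take m s \<noteq> zero_string m \<or> drop m s \<noteq> zero_string n"
      using nz append_take_drop_id[of m s] unfolding zero_string_def replicate_add by metis
    then consider j where "j \<in> outputs m f" "take m s ! j" | j where "j \<in> outputs n g" "drop m s ! j"
      using tensor.IH fs by blast
    then show ?thesis
    proof cases
      case 1
      moreover have "j < m" using 1(1) by (simp add: outputs_def)
      ultimately show ?thesis using low by (intro bexI[of _ j]) auto
    next
      case 2
      then show ?thesis using high[of j] len by (intro bexI[of _ "m + j"]) (auto simp: strings_def)
    qed
  qed
  ultimately show ?case by (auto simp: monotone_on_def)
qed

text \<open>All generators have the same outputs, hence are monotone for one common order, and
  pointwise maxima and minima preserve this.\<close>

lemma regular_subtypes_monotone:
  assumes "f \<in> regular_subtypes n Out"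
  shows "monotone_on (strings n) (string_le n Out) (\<le>) f"
  using assms unfolding regular_subtypes_def
proof (induction rule: gen_sublattice.induct)
  case (base f)
  then show ?case using type_fn_monotone_bounded unfolding type_fns_with_outputs_def by blast
qed (auto simp: monotone_on_def)

section \<open>Construction of the separating type functions\<close>

text \<open>\<open>p\<^sub>T\<close> is a tensor product of one-bit factors, each the constant 1 or
  its complement; the induction splits off the last bit.\<close>

lemma type_fn_p_fn: "n \<ge> 1 \<Longrightarrow> T \<subseteq> {..<n} \<Longrightarrow> type_fn n (p_fn n T)"
proof -
  have one: "type_fn 1 (p_fn 1 {})" "type_fn 1 (p_fn 1 {0})"
  proof -
    have "compl_fn 1 (p_fn 1 {}) = p_fn 1 {0}"
      by (auto simp: p_fn_def compl_fn_def eq_zero_string_iff fun_eq_iff)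
    then show "type_fn 1 (p_fn 1 {})" "type_fn 1 (p_fn 1 {0})"
      using type_fn.one type_fn.compl[OF type_fn.one] by auto
  qed
  have "type_fn n (p_fn n T)" if "n \<ge> 1" "T \<subseteq> {..<n}" for T
    using that
  proof (induction n arbitrary: T rule: nat_induct_at_least)
    case base
    then have "T = {} \<or> T = {0}" by auto
    then show ?case using one by auto
  next
    case (Suc n)
    define E :: "nat set" where "E = (if n \<in> T then {0} else {})"
    have "p_fn (n + 1) T = tensor_fn n 1 (p_fn n (T - {n})) (p_fn 1 E)"
    proof
      fix s :: "bool list"
      have "take n s ! i = s ! i" if "i \<in> T - {n}" for i
        using that Suc.prems by (auto simp: less_Suc_eq)
      then have "(\<forall>i\<in>T. \<not> s ! i) \<longleftrightarrow> (\<forall>i\<in>T - {n}. \<not> take n s ! i) \<and> (n \<in> T \<longrightarrow> \<not> s ! n)"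
        by blast
      then show "p_fn (n + 1) T s = tensor_fn n 1 (p_fn n (T - {n})) (p_fn 1 E) s"
        unfolding p_fn_def tensor_fn_def strings_def E_def by auto
    qed
    moreover have "T - {n} \<subseteq> {..<n}" using Suc.prems by (auto simp: less_Suc_eq)
    moreover have "type_fn 1 (p_fn 1 E)" using one by (auto simp: E_def)
    ultimately show ?case
      using type_fn.tensor[OF Suc.IH, of "T - {n}" 1 "p_fn 1 E"] by (simp only: Suc_eq_plus1)
  qed
  then show "n \<ge> 1 \<Longrightarrow> T \<subseteq> {..<n} \<Longrightarrow> type_fn n (p_fn n T)" .
qed

text \<open>A duplicate-free enumeration \<open>xs\<close> of the positions is a permutation in list
  form. It lets a type function be assembled from consecutive blocks and then moved to arbitrary
  positions.\<close>

lemma type_fn_rearrange: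
  assumes "type_fn n g" "distinct xs" "set xs = {..<n}"
  shows "type_fn n (\<lambda>s. s \<in> strings n \<and> g (map ((!) s) xs))"
proof -
  define \<pi> where "\<pi> k = (if k < n then xs ! k else k)" for k
  have len: "length xs = n" using assms(2,3) distinct_card by fastforce
  then have "bij_betw ((!) xs) {..<n} {..<n}" using assms(2,3) bij_betw_nth by blast
  then have "bij_betw \<pi> {..<n} {..<n}"
    by (subst bij_betw_cong[where g = "(!) xs"]) (auto simp: \<pi>_def)
  then have \<pi>: "\<pi> permutes {..<n}" by (rule bij_imp_permutes) (simp add: \<pi>_def)
  \<comment> \<open>\<open>perm_string\<close> inverts its permutation, so \<open>inv \<pi>\<close>
    has to be supplied for place \<open>k\<close> to read the bit \<open>xs ! k\<close>.\<close>
  have eq: "perm_string (inv \<pi>) s = map ((!) s) xs" if "s \<in> strings n" for s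
    using that len permutes_inv_inv[OF \<pi>]
    by (auto simp: perm_string_def permute_list_def \<pi>_def strings_def list_eq_iff_nth_eq)
  have "perm_string (inv \<pi>) s \<notin> strings n" if "s \<notin> strings n" for s
    using that by (simp add: perm_string_def strings_def)
  then have "(\<lambda>s. s \<in> strings n \<and> g (map ((!) s) xs)) = g \<circ> perm_string (inv \<pi>)"
    using eq type_fn_in_bool_fns[OF assms(1)] by (fastforce simp: fun_eq_iff bool_fns_def)
  then show ?thesis using type_fn.perm[OF assms(1) permutes_inv[OF \<pi>]] by simp
qed

text \<open>On the places \<open>insert i J\<close> this is \<open>p\<^sub>O\<^sup>*\<close> with
  the single output \<open>i\<close> and inputs \<open>J\<close>; it is tensored with the constant 1
  on all other places.\<close>

definition flow_fn :: "nat \<Rightarrow> nat \<Rightarrow> nat set \<Rightarrow> bool list \<Rightarrow> bool" where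
  "flow_fn n i J = (\<lambda>s. s \<in> strings n \<and> (s ! i \<or> (\<forall>j\<in>J. \<not> s ! j)))"

lemma type_fn_flow_fn:
  assumes "i < n" "J \<subseteq> {..<n}" "i \<notin> J"
  shows "type_fn n (flow_fn n i J)"
proof -
  have finJ: "finite J" using assms(2) finite_subset by blast
  define xs where "xs = sorted_list_of_set ({..<n} - insert i J)"
  define ys where "ys = i # sorted_list_of_set J"
  define a b where "a = length xs" and "b = length ys"
  define h where "h = compl_fn b (p_fn b {0})"
  \<comment> \<open>There are no type functions on zero bits, so an empty block of free places
    cannot be a tensor factor. Index 0 in \<open>h\<close> is \<open>i\<close>, the head of
    \<open>ys\<close>.\<close>
  define g where "g = (if a = 0 then h else tensor_fn a b (p_fn a {}) h)"
  have dist: "distinct (xs @ ys)" and set: "set (xs @ ys) = {..<n}"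
    using assms finJ by (auto simp: xs_def ys_def)
  have n: "a + b = n" using distinct_card[OF dist] set by (simp add: a_def b_def)
  have "type_fn b h" unfolding h_def b_def ys_def by (intro type_fn.compl type_fn_p_fn) auto
  then have "type_fn n g"
    using n type_fn_p_fn[of a "{}"] type_fn.tensor[of a "p_fn a {}" b h] by (auto simp: g_def)
  from type_fn_rearrange[OF this dist set]
  have "type_fn n (\<lambda>s. s \<in> strings n \<and> g (map ((!) s) (xs @ ys)))" .
  moreover have "g (map ((!) s) (xs @ ys)) \<longleftrightarrow> h (map ((!) s) ys)" for s
    by (auto simp: g_def a_def b_def tensor_fn_def p_fn_def strings_def)
  moreover have "h (map ((!) s) ys) \<longleftrightarrow> s ! i \<or> (\<forall>j\<in>J. \<not> s ! j)" for s
  proof -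
    have "map ((!) s) ys \<in> strings b" by (simp add: strings_def b_def)
    moreover have "map ((!) s) ys = zero_string b \<longleftrightarrow> (\<forall>j\<in>insert i J. \<not> s ! j)"
      using finJ map_eq_conv[of "(!) s" ys "\<lambda>_. False"]
      by (auto simp: ys_def b_def zero_string_def map_replicate_const)
    moreover have "map ((!) s) ys ! 0 = s ! i" by (simp add: ys_def)
    ultimately show ?thesis by (auto simp: h_def compl_fn_def p_fn_def)
  qed
  ultimately show ?thesis by (simp add: flow_fn_def)
qed

lemma outputs_p_fn: "T \<subseteq> {..<n} \<Longrightarrow> outputs n (p_fn n T) = {..<n} - T"
  by (auto simp: outputs_def p_fn_def unit_string_in_strings nth_unit_string subset_iff)

lemma outputs_flow_fn:
  assumes "i < n" "J \<subseteq> {..<n}" "i \<notin> J"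
  shows "outputs n (flow_fn n i J) = {..<n} - J"
  using assms by (auto simp: outputs_def flow_fn_def unit_string_in_strings nth_unit_string subset_iff)

section \<open>Separation of points and regularity of monotone subtypes\<close>

text \<open>The conditions on \<open>u\<close> and \<open>v\<close> say that
  \<open>p\<^sub>O\<^sup>*\<close> is 1 at \<open>u\<close> and \<open>p\<^sub>I\<close> is 0 at
  \<open>v\<close>, as holds when a subtype is 1 at \<open>u\<close> and 0 at
  \<open>v\<close>.\<close>

lemma separating_type_fn:
  assumes "n \<ge> 1" "Out \<subseteq> {..<n}" and st: "u \<in> strings n" "v \<in> strings n"
    and u: "u = zero_string n \<or> (\<exists>j\<in>Out. u ! j)"
    and v: "\<exists>i\<in>{..<n} - Out. v ! i"
    and not_le: "\<not> string_le n Out u v"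
  shows "\<exists>t\<in>type_fns_with_outputs n Out. t u \<and> \<not> t v"
proof -
  let ?In = "{..<n} - Out"
  have compl: "{..<n} - ?In = Out" using assms(2) by auto
  have v0: "v \<noteq> zero_string n" using v eq_zero_string_iff[OF st(2)] by auto
  \<comment> \<open>The separating functions are, in order, \<open>p\<^sub>I\<close>,
    \<open>p\<^sub>O\<^sup>*\<close>, the flow from all inputs to \<open>i\<close>, and the
    complement of the flow from all outputs to \<open>i\<close>. The last two cases are the two ways
    for \<open>string_le\<close> to fail at \<open>i\<close>.\<close>
  consider "\<forall>i\<in>?In. \<not> u ! i" | "\<forall>i\<in>Out. \<not> v ! i" "\<exists>i\<in>?In. u ! i"
    | i where "i \<in> Out" "u ! i" "\<not> v ! i"
    | i where "i \<in> ?In" "\<not> u ! i" "v ! i" "\<exists>j\<in>?In. u ! j" "\<exists>j\<in>Out. v ! j"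
    using not_le by (auto simp: string_le_def split: if_splits)
  then show ?thesis
  proof cases
    case 1
    have "p_fn n ?In \<in> type_fns_with_outputs n Out"
      using assms(1) compl outputs_p_fn[of ?In n]
      by (simp add: type_fns_with_outputs_def type_fn_p_fn)
    then show ?thesis using 1 v st by (auto simp: p_fn_def intro!: bexI[of _ "p_fn n ?In"])
  next
    case 2
    have "compl_fn n (p_fn n Out) \<in> type_fns_with_outputs n Out"
      using assms(1,2) compl
      by (simp add: type_fns_with_outputs_def type_fn_p_fn type_fn.compl outputs_compl_fn outputs_p_fn)
    then show ?thesis using 2 u v0 st
      by (intro bexI[of _ "compl_fn n (p_fn n Out)"]) (auto simp: p_fn_def compl_fn_def)
  next
    case 3
    have "flow_fn n i ?In \<in> type_fns_with_outputs n Out"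
      using 3(1) assms(2) type_fn_flow_fn[of i n ?In] outputs_flow_fn[of i n ?In]
      unfolding type_fns_with_outputs_def compl by blast
    then show ?thesis using 3 v st
      by (intro bexI[of _ "flow_fn n i ?In"]) (auto simp: flow_fn_def)
  next
    case 4
    have "compl_fn n (flow_fn n i Out) \<in> type_fns_with_outputs n Out"
      using 4(1) assms(2) compl
      by (simp add: type_fns_with_outputs_def type_fn_flow_fn type_fn.compl outputs_compl_fn outputs_flow_fn)
    \<comment> \<open>A 1 of \<open>u\<close> at an input excludes the zero string. The 1 at an
      output then makes the flow false at \<open>u\<close>.\<close>
    moreover have "\<exists>j\<in>Out. u ! j"
      using u 4(4) eq_zero_string_iff[OF st(1)] by auto
    ultimately show ?thesis using 4 v0 st
      by (intro bexI[of _ "compl_fn n (flow_fn n i Out)"]) (auto simp: flow_fn_def compl_fn_def)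
  qed
qed

lemma monotone_subtype_regular:
  assumes "n \<ge> 1" "subtype n f"
    and mono: "monotone_on (strings n) (string_le n (outputs n f)) (\<le>) f"
  shows "f \<in> regular_subtypes n (outputs n f)"
proof -
  let ?Out = "outputs n f"
  have f: "f \<in> bool_fns n" and bound: "f \<le> compl_fn n (p_fn n ?Out)"
    using assms(2) by (auto simp: subtype_def)
  have supp: "s \<in> strings n" if "f s" for s using that f by (auto simp: bool_fns_def)
  show ?thesis
  proof (cases "\<exists>v\<in>strings n. \<not> f v")
    \<comment> \<open>With no \<open>v\<close> to separate from, the meets would be empty; but here
      \<open>f\<close> is the constant 1, itself a type function.\<close>
    case False
    then have "f = p_fn n {}" using supp by (auto simp: p_fn_def fun_eq_iff)
    then show ?thesis
      using type_fn_p_fn[OF assms(1)]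
      by (auto simp: regular_subtypes_def type_fns_with_outputs_def intro!: gen_sublattice.base)
  next
    case True
    show ?thesis unfolding regular_subtypes_def
    proof (rule gen_sublattice_if_separating[OF finite_strings supp _ _ True])
      show "\<exists>u. f u" using f by (auto simp: bool_fns_def)
      show "x \<in> strings n" if "t \<in> type_fns_with_outputs n ?Out" "t x" for t x
        using that type_fn_in_bool_fns by (auto simp: type_fns_with_outputs_def bool_fns_def)
    next
      fix u v assume uv: "f u" "v \<in> strings n" "\<not> f v"
      show "\<exists>t\<in>type_fns_with_outputs n ?Out. t u \<and> \<not> t v"
      proof (rule separating_type_fn[OF assms(1) _ supp[OF uv(1)] uv(2)])
        show "?Out \<subseteq> {..<n}" by (auto simp: outputs_def)
        show "u = zero_string n \<or> (\<exists>j\<in>?Out. u ! j)"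
          using bound uv(1) supp by (auto simp: le_fun_def compl_fn_def p_fn_def)
        show "\<exists>i\<in>{..<n} - ?Out. v ! i"
          using monotone_if_zero_on_inputs[OF mono f uv(2)] uv(3) by auto
        show "\<not> string_le n ?Out u v"
          using monotone_onD[OF mono supp[OF uv(1)] uv(2)] uv(1,3) by auto
      qed
    qed
  qed
qed

theorem theorem4p6:
  fixes n :: nat and f :: "bool list \<Rightarrow> bool"
  assumes "n \<ge> 1"
    and "f \<in> bool_fns n"
    and "subtype n f"
  shows "f \<in> regular_subtypes n (outputs n f) \<longleftrightarrow>
         monotone_on (strings n) (string_le n (outputs n f)) (\<le>) f"
  using regular_subtypes_monotone monotone_subtype_regular[OF assms(1,3)] by blast

end
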